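(* Let $t\geq 2$ be even and $n\geq 3$. Then \[\operatorname{M}(P_{t}\times K_n)=\operatorname{Z}(P_{t}\times K_n)= (n-2)t.\]
   Context: All graphs are finite, simple and undirected. $P_t$ is the path on $t$ vertices and $K_n$ the complete graph on $n$ vertices. The tensor product $G\times H$ has vertex set $V(G)\times V(H)$, with $(g,h)$ adjacent to $(g',h')$ iff $g\sim g'$ in $G$ and $h\sim h'$ in $H$. For a graph $G$ on vertex set $\{1,\dots,N\}$, $\mathcal{S}(G)$ is the set of real symmetric $N\times N$ matrices $A=[a_{ij}]$ such that for $i\neq j$, $a_{ij}\neq 0$ iff $\{i,j\}$ is an edge of $G$ (diagonal entries are arbitrary); the maximum nullity is $\operatorname{M}(G)=\max\{\operatorname{null} A: A\in\mathcal{S}(G)\}$. Zero forcing: vertices are colored blue or white; if a blue vertex $u$ has exactly one white neighbor $w$, then $w$ is changed to blue. A zero forcing set is a set $B$ of vertices such that, coloring $B$ blue and all others white, repeated application of this rule colors all vertices blue; $\operatorname{Z}(G)$ is the minimum cardinality of a zero forcing set. *)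

theory Defs
  imports "Graph_Theory.Pair_Digraph" "Jordan_Normal_Form.Matrix_Kernel"
begin

text \<open>
  A finite simple undirected graph is a \<^locale>\<open>pair_graph\<close>: an edge is represented by
  the two arcs joining its endpoints.
\<close>

definition path_graph :: "nat \<Rightarrow> nat pair_pre_digraph" where
  "path_graph t = \<lparr> pverts = {0..<t},
     parcs = {(i, j). i < t \<and> j < t \<and> (j = Suc i \<or> i = Suc j)} \<rparr>"

definition complete_graph :: "nat \<Rightarrow> nat pair_pre_digraph" where
  "complete_graph n = \<lparr> pverts = {0..<n}, parcs = {(i, j). i < n \<and> j < n \<and> i \<noteq> j} \<rparr>"

definition tensor_product ::
    "'a pair_pre_digraph \<Rightarrow> 'b pair_pre_digraph \<Rightarrow> ('a \<times> 'b) pair_pre_digraph" where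
  "tensor_product G H = \<lparr> pverts = pverts G \<times> pverts H,
     parcs = {((g, h), (g', h')). (g, g') \<in> parcs G \<and> (h, h') \<in> parcs H} \<rparr>"

text \<open>
  Matrices are indexed by \<open>{0..<N}\<close>, so a graph with another vertex set is first relabelled
  by a bijection. The set below contains the matrices for all labellings; these differ only by
  simultaneous permutations of rows and columns, which do not affect the nullity.
\<close>

definition sym_matrices :: "'a pair_pre_digraph \<Rightarrow> real mat set" where
  "sym_matrices G = {A. \<exists>f. bij_betw f {0..<card (pverts G)} (pverts G) \<and>
     A \<in> carrier_mat (card (pverts G)) (card (pverts G)) \<and>
     transpose_mat A = A \<and>
     (\<forall>i < card (pverts G). \<forall>j < card (pverts G).
        i \<noteq> j \<longrightarrow> (A $$ (i, j) \<noteq> 0 \<longleftrightarrow> (f i, f j) \<in> parcs G))}"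

definition max_nullity :: "'a pair_pre_digraph \<Rightarrow> nat" where
  "max_nullity G = Max (kernel_dim ` sym_matrices G)"

definition force_step :: "'a pair_pre_digraph \<Rightarrow> 'a set \<Rightarrow> 'a set \<Rightarrow> bool" where
  "force_step G B B' \<longleftrightarrow>
     (\<exists>u \<in> B. \<exists>w. {v. (u, v) \<in> parcs G \<and> v \<notin> B} = {w} \<and> B' = insert w B)"

definition zero_forcing_set :: "'a pair_pre_digraph \<Rightarrow> 'a set \<Rightarrow> bool" where
  "zero_forcing_set G B \<longleftrightarrow> B \<subseteq> pverts G \<and> (force_step G)\<^sup>*\<^sup>* B (pverts G)"

definition zero_forcing_number :: "'a pair_pre_digraph \<Rightarrow> nat" where
  "zero_forcing_number G = Min (card ` {B. zero_forcing_set G B})"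

lemma pair_graph_path_graph: "pair_graph (path_graph t)"
proof
  show "finite (parcs (path_graph t))"
    by (rule finite_subset[of _ "{0..<t} \<times> {0..<t}"]) (auto simp: path_graph_def)
qed (auto simp: path_graph_def symmetric_def sym_def)

lemma pair_graph_complete_graph: "pair_graph (complete_graph n)"
proof
  show "finite (parcs (complete_graph n))"
    by (rule finite_subset[of _ "{0..<n} \<times> {0..<n}"]) (auto simp: complete_graph_def)
qed (auto simp: complete_graph_def symmetric_def sym_def)

lemma pair_graph_tensor_product:
  assumes "pair_graph G" "pair_graph H"
  shows "pair_graph (tensor_product G H)"
proof -
  interpret G: pair_graph G by fact
  interpret H: pair_graph H by fact
  show ?thesis
  proof
    show "finite (parcs (tensor_product G H))"
      by (rule finite_subset[of _ "(pverts G \<times> pverts H) \<times> (pverts G \<times> pverts H)"])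
        (auto simp: tensor_product_def G.pair_finite_verts H.pair_finite_verts
          dest: G.in_arcsD1 G.in_arcsD2 H.in_arcsD1 H.in_arcsD2)
    show "symmetric (with_proj (tensor_product G H))"
      using G.pair_sym_arcs H.pair_sym_arcs
      by (auto simp: tensor_product_def symmetric_def sym_def)
    show "fst e \<noteq> snd e" if "e \<in> parcs (tensor_product G H)" for e
      using that by (auto simp: tensor_product_def dest: G.pair_no_loops)
  qed (auto simp: tensor_product_def G.pair_finite_verts H.pair_finite_verts
      dest: G.in_arcsD1 G.in_arcsD2 H.in_arcsD1 H.in_arcsD2)
qed

text \<open>The maximum and the minimum above range over finite nonempty sets.\<close>

lemma finite_nullities: "finite (kernel_dim ` sym_matrices G)"
proof (rule finite_subset)
  show "kernel_dim ` sym_matrices G \<subseteq> {..card (pverts G)}"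
    by (auto simp: sym_matrices_def kernel_dim_code)
qed simp

lemma sym_matrices_nonempty:
  assumes "pair_graph G"
  shows "sym_matrices G \<noteq> {}"
proof -
  interpret pair_graph G by fact
  obtain f where f: "bij_betw f {0..<card (pverts G)} (pverts G)"
    using ex_bij_betw_nat_finite[OF pair_finite_verts] by blast
  have sym: "(u, v) \<in> parcs G \<longleftrightarrow> (v, u) \<in> parcs G" for u v
    using pair_sym_arcs by (auto simp: symmetric_def sym_def)
  define A where "A = mat (card (pverts G)) (card (pverts G))
    (\<lambda>(i, j). if (f i, f j) \<in> parcs G then 1 else (0::real))"
  have "A \<in> sym_matrices G"
    unfolding sym_matrices_def
    by (rule CollectI, rule exI[of _ f]) (auto simp: f A_def intro!: eq_matI dest: sym[THEN iffD1])
  then show ?thesis by blast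
qed

lemma finite_zero_forcing_sets:
  assumes "pair_graph G"
  shows "finite {B. zero_forcing_set G B}"
proof -
  interpret pair_graph G by fact
  show ?thesis
    by (rule finite_subset[of _ "Pow (pverts G)"])
      (auto simp: zero_forcing_set_def pair_finite_verts)
qed

lemma zero_forcing_set_pverts: "zero_forcing_set G (pverts G)"
  by (simp add: zero_forcing_set_def)

end

theory Submission
  imports Defs
begin

text \<open>
  A kernel vector of a matrix in \<open>\<S>(G)\<close> that vanishes on a zero forcing set vanishes everywhere,
  so the nullity is at most the size of any zero forcing set.

  For \<open>P\<^sub>t \<times> K\<^sub>n\<close> a zero forcing set is obtained by leaving two vertices per layer white: the
  columns 0 and 1 in even layers (counting from 0) and 0 and 2 in odd layers. Since \<open>t\<close> is even,
  even layers force upwards from layer 0 and odd layers force downwards from layer \<open>t - 1\<close>.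

  For the lower bound take the Kronecker product of the skew-symmetric signed adjacency matrix of
  \<open>P\<^sub>t\<close> and the skew-symmetric matrix \<open>[a - b]\<^sub>a\<^sub>b\<close> of order \<open>n\<close>. It is symmetric with the right zero
  pattern, and the second factor has rank 2.
\<close>

section \<open>Nullity and zero forcing\<close>

text \<open>Gaussian elimination, by induction on the equations. Unknowns are indexed by an
  arbitrary finite set, so that basis vectors can serve as indices.\<close>

lemma exists_nontrivial_solution:
  fixes g :: "'i \<Rightarrow> 'b \<Rightarrow> 'a :: field"
  assumes "finite I" "finite S" "card I < card S"
  shows "\<exists>a. (\<exists>x\<in>S. a x \<noteq> 0) \<and> (\<forall>i\<in>I. (\<Sum>x\<in>S. a x * g i x) = 0)"
  using assms
proof (induction I arbitrary: S g rule: finite_induct)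
  case empty
  then obtain x where "x \<in> S" by fastforce
  then show ?case by (intro exI[of _ "\<lambda>_. 1"]) auto
next
  case (insert i I)
  show ?case
  proof (cases "\<forall>x\<in>S. g i x = 0")
    case True
    moreover from insert obtain a where "\<exists>x\<in>S. a x \<noteq> 0" "\<forall>i\<in>I. (\<Sum>x\<in>S. a x * g i x) = 0"
      using insert.IH[of S g] by fastforce
    ultimately show ?thesis by (intro exI[of _ a]) auto
  next
    case False
    then obtain y where y: "y \<in> S" "g i y \<noteq> 0" by blast
    define S' where "S' = S - {y}"
    have S: "S = insert y S'" "y \<notin> S'" "finite S'"
      using y insert.prems by (auto simp: S'_def)
    have "card I < card S'"
      using insert.prems insert.hyps S by simp
    then obtain a where a: "\<exists>x\<in>S'. a x \<noteq> 0"
      "\<forall>j\<in>I. (\<Sum>x\<in>S'. a x * (g j x - g j y * g i x / g i y)) = 0"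
      \<comment> \<open>These are the coefficients left after solving equation \<open>i\<close> for
        the unknown at \<open>y\<close> and substituting into equation \<open>j\<close>.\<close>
      using insert.IH[of S' "\<lambda>j x. g j x - g j y * g i x / g i y"] S by blast
    define s where "s = (\<Sum>x\<in>S'. a x * g i x)"
    \<comment> \<open>The value at \<open>y\<close> is the one that equation \<open>i\<close>
      dictates.\<close>
    define b where "b = a(y := - s / g i y)"
    have b: "(\<Sum>x\<in>S. b x * g j x) = - s / g i y * g j y + (\<Sum>x\<in>S'. a x * g j x)" for j
    proof -
      have "(\<Sum>x\<in>S'. b x * g j x) = (\<Sum>x\<in>S'. a x * g j x)"
        using S by (intro sum.cong) (auto simp: b_def)
      then show ?thesis using S by (simp add: b_def)
    qed
    have "(\<Sum>x\<in>S. b x * g j x) = 0" if "j \<in> I" for j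
    proof -
      have "0 = (\<Sum>x\<in>S'. a x * (g j x - g j y * g i x / g i y))"
        using a(2) that by simp
      also have "\<dots> = (\<Sum>x\<in>S'. a x * g j x - (g j y / g i y) * (a x * g i x))"
        by (intro sum.cong) (simp_all add: algebra_simps)
      also have "\<dots> = (\<Sum>x\<in>S'. a x * g j x) - (g j y / g i y) * s"
        by (simp add: sum_subtractf sum_distrib_left s_def)
      finally show ?thesis by (simp add: b)
    qed
    moreover have "(\<Sum>x\<in>S. b x * g i x) = 0"
      using y by (simp add: b s_def)
    moreover have "\<exists>x\<in>S. b x \<noteq> 0"
      using a(1) S by (auto simp: b_def)
    ultimately show ?thesis by (intro exI[of _ b]) auto
  qed
qed

text \<open>With more than \<open>card I\<close> basis vectors, requiring a combination to vanish on
  \<open>I\<close> leaves a nontrivial choice of coefficients. That combination is the zero vector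
  by \<open>zero\<close>, against independence.\<close>

lemma kernel_dim_le_card:
  fixes A :: "'a :: field mat"
  assumes A: "A \<in> carrier_mat nr nc" and I: "I \<subseteq> {0..<nc}"
    and zero: "\<And>v. v \<in> mat_kernel A \<Longrightarrow> \<forall>i\<in>I. v $ i = 0 \<Longrightarrow> v = 0\<^sub>v nc"
  shows "kernel_dim A \<le> card I"
proof (rule ccontr)
  interpret kernel nr nc A by unfold_locales (rule A)
  obtain S where S: "finite S" "basis S"
    using kernel_basis_exists[OF A] by blast
  have SK: "S \<subseteq> mat_kernel A" and indep: "\<not> Ker.lin_dep S"
    using S(2) by (auto simp: Ker.basis_def)
  assume "\<not> kernel_dim A \<le> card I"
  then have "card I < card S"
    using Ker.dim_basis[OF S] by simp
  moreover have "finite I" using I finite_subset by blast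
  ultimately obtain a x where a: "x \<in> S" "a x \<noteq> 0" "\<forall>i\<in>I. (\<Sum>x\<in>S. a x * x $ i) = 0"
    using exists_nontrivial_solution[OF _ S(1), of I "\<lambda>i x. x $ i"] by blast
  have "lincomb a S \<in> mat_kernel A"
    using Ker.lincomb_closed[of S a] SK by auto
  moreover have "\<forall>i\<in>I. lincomb a S $ i = 0"
    using a(3) I lincomb_index[OF _ SK] by auto
  ultimately have "lincomb a S = 0\<^sub>v nc"
    by (rule zero)
  then have "Ker.lin_dep S"
    unfolding Ker.lin_dep_def using S(1) a by (intro exI[of _ S] exI[of _ a] exI[of _ x]) auto
  with indep show False by blast
qed

text \<open>Coordinate \<open>k\<close> of a linear combination of the \<open>v j\<close> is exactly
  the coefficient of \<open>v k\<close>, so these vectors are independent.\<close>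

lemma card_le_kernel_dim:
  fixes A :: "'a :: field mat"
  assumes A: "A \<in> carrier_mat nr nc" and J: "J \<subseteq> {0..<nc}"
    and ker: "\<And>j. j \<in> J \<Longrightarrow> v j \<in> mat_kernel A"
    and unit: "\<And>j k. j \<in> J \<Longrightarrow> k \<in> J \<Longrightarrow> v j $ k = (if j = k then 1 else 0)"
  shows "card J \<le> kernel_dim A"
proof -
  interpret kernel nr nc A by unfold_locales (rule A)
  have finJ: "finite J" using J finite_subset by blast
  have inj: "inj_on v J"
    by (intro inj_onI) (metis unit zero_neq_one)
  have SK: "v ` J \<subseteq> mat_kernel A" using ker by auto
  have "\<not> Ker.lin_dep (v ` J)"
  proof (rule Ker.finite_lin_indpt2)
    fix a assume "lincomb a (v ` J) = 0\<^sub>v nc"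
    show "\<forall>x\<in>v ` J. a x = 0"
    proof safe
      fix k assume k: "k \<in> J"
      have "0 = lincomb a (v ` J) $ k"
        using \<open>lincomb a (v ` J) = 0\<^sub>v nc\<close> k J by auto
      also have "\<dots> = (\<Sum>j\<in>J. a (v j) * v j $ k)"
        using lincomb_index[OF _ SK, of k a] k J by (simp add: sum.reindex[OF inj] subset_iff)
      also have "\<dots> = (\<Sum>j\<in>J. if j = k then a (v j) else 0)"
        using unit k by (intro sum.cong) auto
      also have "\<dots> = a (v k)" using finJ k by simp
      finally show "a (v k) = 0" by simp
    qed
  qed (use finJ SK in auto)
  moreover have "Ker.fin_dim"
    using kernel_basis_exists[OF A] by (auto simp: Ker.fin_dim_def Ker.basis_def)
  ultimately have "card (v ` J) \<le> dim"
    using Ker.li_le_dim(2) SK by blast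
  then show ?thesis by (simp add: card_image[OF inj])
qed

section \<open>Zero forcing and kernel vectors\<close>

text \<open>When \<open>u\<close> forces \<open>w\<close>, row \<open>u\<close> of
  \<open>A *\<^sub>v v = 0\<close> reduces to the single term at \<open>w\<close>, whose matrix
  entry is nonzero.\<close>

lemma force_steps_kernel_zero:
  assumes G: "pair_graph G" and f: "bij_betw f {0..<N} (pverts G)"
    and A: "A \<in> carrier_mat N N"
    and pat: "\<And>i j. i < N \<Longrightarrow> j < N \<Longrightarrow> i \<noteq> j \<Longrightarrow> A $$ (i, j) \<noteq> (0::real) \<longleftrightarrow> (f i, f j) \<in> parcs G"
    and v: "v \<in> mat_kernel A"
    and steps: "(force_step G)\<^sup>*\<^sup>* B B'" and B: "B \<subseteq> pverts G"
    and zero: "\<And>i. i < N \<Longrightarrow> f i \<in> B \<Longrightarrow> v $ i = 0"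
  shows "B' \<subseteq> pverts G \<and> (\<forall>i<N. f i \<in> B' \<longrightarrow> v $ i = 0)"
  using steps
proof (induction rule: rtranclp_induct)
  case base
  then show ?case using B zero by blast
next
  case (step C D)
  interpret pair_graph G by fact
  from step.hyps obtain u w where uw: "u \<in> C" "{x. (u, x) \<in> parcs G \<and> x \<notin> C} = {w}" "D = insert w C"
    unfolding force_step_def by blast
  then have w: "(u, w) \<in> parcs G" "w \<notin> C" by auto
  have wV: "w \<in> pverts G" using w(1) by (rule in_arcsD2)
  have "u \<in> pverts G" using uw(1) step.IH by blast
  then obtain i where i: "i < N" "f i = u"
    using f by (force simp: bij_betw_def)
  obtain k where k: "k < N" "f k = w"
    using f wV by (force simp: bij_betw_def)
  have ik: "i \<noteq> k" using i k uw(1) w(2) by blast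
  \<comment> \<open>The diagonal term falls under the blue case since \<open>u\<close> itself is
    blue; its matrix entry is arbitrary. A white vertex other than \<open>w\<close> is no neighbour
    of \<open>u\<close>.\<close>
  have others: "A $$ (i, l) * v $ l = 0" if l: "l < N" "l \<noteq> k" for l
  proof (cases "f l \<in> C")
    case True
    then show ?thesis using step.IH l by simp
  next
    case False
    have "f l \<noteq> w" using f k l by (auto simp: bij_betw_def inj_on_def)
    then have "(f i, f l) \<notin> parcs G" using uw(2) False i by blast
    moreover have "i \<noteq> l" using False uw(1) i by blast
    ultimately show ?thesis using pat[OF i(1) l(1)] by simp
  qed
  have vN: "v \<in> carrier_vec N" "A *\<^sub>v v = 0\<^sub>v N"
    using mat_kernelD[OF A v] by auto
  have "0 = (A *\<^sub>v v) $ i" using vN i by simp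
  also have "\<dots> = (\<Sum>l\<in>{0..<N}. A $$ (i, l) * v $ l)"
    using A vN(1) i by (auto simp: scalar_prod_def)
  also have "\<dots> = A $$ (i, k) * v $ k"
    using k others by (subst sum.remove[of _ k]) (auto intro!: sum.neutral simp del: mult_eq_0_iff)
  finally have "v $ k = 0"
    using pat[OF i(1) k(1) ik] w(1) i k by auto
  moreover have "l = k" if "l < N" "f l = w" for l
    using f k that by (auto simp: bij_betw_def inj_on_def)
  ultimately show ?case using step.IH wV uw(3) by auto
qed

lemma max_nullity_le_card_zero_forcing_set:
  assumes G: "pair_graph G" and B: "zero_forcing_set G B"
  shows "max_nullity G \<le> card B"
proof -
  interpret pair_graph G by fact
  have "kernel_dim A \<le> card B" if "A \<in> sym_matrices G" for A
  proof -
    let ?N = "card (pverts G)"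
    from that obtain f where f: "bij_betw f {0..<?N} (pverts G)" and A: "A \<in> carrier_mat ?N ?N"
      and pat: "\<And>i j. i < ?N \<Longrightarrow> j < ?N \<Longrightarrow> i \<noteq> j \<Longrightarrow> A $$ (i, j) \<noteq> 0 \<longleftrightarrow> (f i, f j) \<in> parcs G"
      unfolding sym_matrices_def by blast
    define I where "I = {i\<in>{0..<?N}. f i \<in> B}"
    have "kernel_dim A \<le> card I"
    proof (rule kernel_dim_le_card[OF A])
      fix v assume v: "v \<in> mat_kernel A" "\<forall>i\<in>I. v $ i = 0"
      have "\<forall>i<?N. f i \<in> pverts G \<longrightarrow> v $ i = 0"
        using force_steps_kernel_zero[OF G f A pat v(1), of B "pverts G"] B v(2)
        by (auto simp: zero_forcing_set_def I_def)
      then show "v = 0\<^sub>v ?N"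
        using mat_kernelD(1)[OF A v(1)] f by (intro eq_vecI) (auto simp: bij_betw_def)
    qed (auto simp: I_def)
    also have "card I \<le> card B"
    proof (rule card_inj_on_le[of f])
      show "inj_on f I"
        using f by (auto simp: bij_betw_def I_def intro: inj_on_subset)
      show "finite B"
        using B by (auto simp: zero_forcing_set_def intro: finite_subset)
    qed (auto simp: I_def)
    finally show ?thesis .
  qed
  then show ?thesis
    unfolding max_nullity_def using finite_nullities sym_matrices_nonempty[OF G] by (subst Max_le_iff) auto
qed

lemma max_nullity_le_zero_forcing_number:
  assumes "pair_graph G"
  shows "max_nullity G \<le> zero_forcing_number G"
  unfolding zero_forcing_number_def
  using assms zero_forcing_set_pverts[of G]
  by (subst Min_ge_iff)
    (auto simp: finite_zero_forcing_sets intro!: max_nullity_le_card_zero_forcing_set)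

text \<open>Lets the matrix and its kernel vectors be indexed by vertices; a labelling
  \<open>f\<close> carries both over to \<open>{0..<N}\<close>.\<close>

lemma card_le_max_nullity:
  fixes M :: "'a \<Rightarrow> 'a \<Rightarrow> real"
  assumes G: "pair_graph G"
    and sym: "\<And>u w. M u w = M w u"
    and pat: "\<And>u w. u \<in> pverts G \<Longrightarrow> w \<in> pverts G \<Longrightarrow> u \<noteq> w \<Longrightarrow> M u w \<noteq> 0 \<longleftrightarrow> (u, w) \<in> parcs G"
    and J: "J \<subseteq> pverts G"
    and ker: "\<And>j u. j \<in> J \<Longrightarrow> u \<in> pverts G \<Longrightarrow> (\<Sum>w\<in>pverts G. M u w * x j w) = 0"
    and unit: "\<And>j k. j \<in> J \<Longrightarrow> k \<in> J \<Longrightarrow> x j k = (if j = k then 1 else 0)"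
  shows "card J \<le> max_nullity G"
proof -
  interpret pair_graph G by fact
  let ?N = "card (pverts G)"
  obtain f where f: "bij_betw f {0..<?N} (pverts G)"
    using ex_bij_betw_nat_finite[OF pair_finite_verts] by blast
  then have inj: "inj_on f {0..<?N}" and img: "f ` {0..<?N} = pverts G"
    by (auto simp: bij_betw_def)
  have fV: "f i \<in> pverts G" if "i < ?N" for i using img that by auto
  define A where "A = mat ?N ?N (\<lambda>(i, j). M (f i) (f j))"
  define J' where "J' = {i\<in>{0..<?N}. f i \<in> J}"
  have A: "A \<in> carrier_mat ?N ?N" by (simp add: A_def)
  have neq: "f i \<noteq> f j" if "i < ?N" "j < ?N" "i \<noteq> j" for i j
    using inj that by (auto simp: inj_on_def)
  have "A \<in> sym_matrices G"
    unfolding sym_matrices_def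
    using f sym pat fV neq by (intro CollectI exI[of _ f]) (auto simp: A_def intro!: eq_matI)
  moreover have "card J' \<le> kernel_dim A"
  proof (rule card_le_kernel_dim[OF A, where v = "\<lambda>j. vec ?N (\<lambda>i. x (f j) (f i))"])
    fix j assume j: "j \<in> J'"
    show "vec ?N (\<lambda>i. x (f j) (f i)) \<in> mat_kernel A"
    proof (rule mat_kernelI[OF A])
      show "A *\<^sub>v vec ?N (\<lambda>i. x (f j) (f i)) = 0\<^sub>v ?N"
      proof (rule eq_vecI)
        fix i assume "i < dim_vec (0\<^sub>v ?N :: real vec)"
        then have i: "i < ?N" by simp
        then have "(A *\<^sub>v vec ?N (\<lambda>i. x (f j) (f i))) $ i =
            (\<Sum>l\<in>{0..<?N}. M (f i) (f l) * x (f j) (f l))"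
          by (auto simp: A_def scalar_prod_def intro!: sum.cong)
        also have "\<dots> = (\<Sum>w\<in>pverts G. M (f i) w * x (f j) w)"
          using sum.reindex_bij_betw[OF f, of "\<lambda>w. M (f i) w * x (f j) w"] .
        also have "\<dots> = 0" using ker j fV[OF i] by (auto simp: J'_def)
        finally show "(A *\<^sub>v vec ?N (\<lambda>i. x (f j) (f i))) $ i = 0\<^sub>v ?N $ i" using i by simp
      qed (simp add: A_def)
    qed simp
  next
    fix j k assume "j \<in> J'" "k \<in> J'"
    then show "vec ?N (\<lambda>i. x (f j) (f i)) $ k = (if j = k then 1 else 0)"
      using unit neq by (auto simp: J'_def)
  qed (auto simp: J'_def)
  moreover have "card J = card J'"
  proof -
    have "f ` J' = J" using img J by (force simp: J'_def)
    moreover have "inj_on f J'" using inj by (rule inj_on_subset) (auto simp: J'_def)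
    ultimately show ?thesis using card_image by blast
  qed
  ultimately show ?thesis
    unfolding max_nullity_def using finite_nullities[of G]
    by (metis Max_ge image_eqI le_trans)
qed

text \<open>Performs a whole sweep of forces \<open>w 0\<close>, \<open>w 1\<close>, ... at once;
  all forcing vertices are blue before the sweep starts.\<close>

lemma force_steps_chain:
  fixes m :: nat
  assumes u: "\<And>k. k < m \<Longrightarrow> u k \<in> B"
    and w: "\<And>k. k < m \<Longrightarrow> {v. (u k, v) \<in> parcs G \<and> v \<notin> B \<union> w ` {..<k}} = {w k}"
  shows "(force_step G)\<^sup>*\<^sup>* B (B \<union> w ` {..<m})"
  using assms
proof (induction m)
  case (Suc m)
  then have "(force_step G)\<^sup>*\<^sup>* B (B \<union> w ` {..<m})" by simp
  moreover have "force_step G (B \<union> w ` {..<m}) (B \<union> w ` {..<Suc m})"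
    unfolding force_step_def using Suc.prems(1)[of m] Suc.prems(2)[of m]
    by (intro bexI[of _ "u m"] exI[of _ "w m"]) (auto simp: lessThan_Suc)
  ultimately show ?case by (rule rtranclp.rtrancl_into_rtrancl)
qed simp

section \<open>The tensor product of a path and a complete graph\<close>

abbreviation (input) path_times_complete :: "nat \<Rightarrow> nat \<Rightarrow> (nat \<times> nat) pair_pre_digraph" where
  "path_times_complete t n \<equiv> tensor_product (path_graph t) (complete_graph n)"

lemma pverts_path_times_complete [simp]:
  "pverts (path_times_complete t n) = {0..<t} \<times> {0..<n}"
  by (simp add: tensor_product_def path_graph_def complete_graph_def)

lemma parcs_path_times_complete [simp]:
  "((i, a), (j, b)) \<in> parcs (path_times_complete t n) \<longleftrightarrow>
     i < t \<and> j < t \<and> (j = Suc i \<or> i = Suc j) \<and> a < n \<and> b < n \<and> a \<noteq> b"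
  by (auto simp: tensor_product_def path_graph_def complete_graph_def)

lemma pair_graph_path_times_complete: "pair_graph (path_times_complete t n)"
  by (simp add: pair_graph_tensor_product pair_graph_path_graph pair_graph_complete_graph)

section \<open>Lower bound on the maximum nullity\<close>

lemma max_nullity_path_times_complete_ge:
  assumes "n \<ge> 2"
  shows "(n - 2) * t \<le> max_nullity (path_times_complete t n)"
proof -
  define S where "S = (\<lambda>i j. if j = Suc i then 1 else if i = Suc j then - 1 else (0::real))"
  define M where "M = (\<lambda>(i, a) (j, b). S i j * (real a - real b))"
  \<comment> \<open>The vector with entry 1 at \<open>c\<close> and supported on \<open>{0, 1, c}\<close>
    that is orthogonal to \<open>(1)\<^sub>b\<close> and to \<open>(b)\<^sub>b\<close>.\<close>
  define y where "y = (\<lambda>c b. (if b = c then 1 else 0) + (if b = 0 then real c - 1 else 0)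
    - (if b = (1::nat) then real c else 0))"
  \<comment> \<open>A copy of \<open>y c\<close> placed in the single layer \<open>i\<close>, so the
    path factor of \<open>M\<close> pulls out of the row sum.\<close>
  define x where "x = (\<lambda>(i, c) (j, b). (if i = (j::nat) then y c b else 0))"
  have y: "(\<Sum>b\<in>{0..<n}. (real a - real b) * y c b) = 0" if "c < n" for a c
  proof -
    have "(\<Sum>b\<in>{0..<n}. (real a - real b) * y c b) =
        (\<Sum>b\<in>{0..<n}. (if b = c then real a - real c else 0) + (if b = 0 then real a * (real c - 1) else 0)
          - (if b = 1 then (real a - 1) * real c else 0))"
      by (intro sum.cong) (auto simp: y_def algebra_simps)
    also have "\<dots> = 0"
      using that assms by (simp add: sum.distrib sum_subtractf algebra_simps)
    finally show ?thesis .
  qed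
  \<comment> \<open>Columns 0 and 1 absorb the two orthogonality conditions. On columns from 2 on,
    \<open>y c\<close> is the unit vector at \<open>c\<close>, as \<open>unit\<close>
    demands.\<close>
  have "card ({0..<t} \<times> {2..<n}) \<le> max_nullity (path_times_complete t n)"
  proof (rule card_le_max_nullity[OF pair_graph_path_times_complete, where M = M and x = x])
    fix j u assume j: "j \<in> {0..<t} \<times> {2..<n}" and u: "u \<in> pverts (path_times_complete t n)"
    obtain i a k c where eqs: "u = (i, a)" "j = (k, c)" by fastforce
    have "(\<Sum>w\<in>pverts (path_times_complete t n). M u w * x j w) =
        (\<Sum>l\<in>{0..<t}. \<Sum>b\<in>{0..<n}. M u (l, b) * x j (l, b))"
      by (simp add: sum.cartesian_product)
    also have "\<dots> = (\<Sum>l\<in>{0..<t}. (if k = l then S i l else 0) * (\<Sum>b\<in>{0..<n}. (real a - real b) * y c b))"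
      unfolding sum_distrib_left
      by (intro sum.cong) (auto simp: M_def x_def eqs)
    also have "\<dots> = 0" using y j eqs by simp
    finally show "(\<Sum>w\<in>pverts (path_times_complete t n). M u w * x j w) = 0" .
  qed (auto simp: M_def S_def x_def y_def split: if_splits)
  then show ?thesis by (simp add: mult.commute)
qed

section \<open>Upper bound on the zero forcing number\<close>

text \<open>Four sweeps of \<open>m\<close> forces each: column 0 of the odd layers going up, column
  0 of the even layers going down, then column \<open>p i\<close> in the same order.\<close>

lemma zero_forcing_number_path_times_complete_le:
  assumes t: "even t" and n: "n \<ge> 3"
  shows "zero_forcing_number (path_times_complete t n) \<le> (n - 2) * t"
proof -
  let ?G = "path_times_complete t n"
  define m where "m = t div 2"
  have tm: "t = 2 * m" using t by (simp add: m_def)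
  define V where "V = {0..<t} \<times> {0..<n}"
  define p where "p = (\<lambda>i::nat. if even i then 1 else 2 :: nat)"
  define B where "B = {(i, a) \<in> V. a \<noteq> 0 \<and> a \<noteq> p i}"
  define w1 where "w1 = (\<lambda>k::nat. (2 * k + 1, 0::nat))"
  define w2 where "w2 = (\<lambda>k. (t - 2 - 2 * k, 0::nat))"
  define w3 where "w3 = (\<lambda>k::nat. (2 * k + 1, 2::nat))"
  define w4 where "w4 = (\<lambda>k. (t - 2 - 2 * k, 1::nat))"
  \<comment> \<open>\<open>up\<close> and \<open>down\<close> turn membership in a partial sweep
    into arithmetic, so that each forcing condition becomes decidable by
    \<open>presburger\<close>.\<close>
  have up: "(i, a) \<in> (\<lambda>k. (2 * k + 1, c)) ` {..<k} \<longleftrightarrow> odd i \<and> i < 2 * k \<and> a = c" for i a c k :: nat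
    by (auto elim!: oddE)
  \<comment> \<open>The bound \<open>k \<le> m\<close> keeps the natural subtraction exact; layer
    \<open>2 * q\<close> is reached at index \<open>m - 1 - q\<close>.\<close>
  have down: "(i, a) \<in> (\<lambda>k. (t - 2 - 2 * k, c)) ` {..<k} \<longleftrightarrow>
      even i \<and> t - 2 * k \<le> i \<and> i < t \<and> a = c" if "k \<le> m" for i a c k :: nat
  proof
    assume R: "even i \<and> t - 2 * k \<le> i \<and> i < t \<and> a = c"
    then obtain q where "i = 2 * q" by blast
    with R that show "(i, a) \<in> (\<lambda>k. (t - 2 - 2 * k, c)) ` {..<k}"
      by (intro image_eqI[of _ _ "m - 1 - q"]) (auto simp: tm)
  qed (use that in \<open>auto simp: tm\<close>)
  define B1 where "B1 = B \<union> w1 ` {..<m}"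
  define B2 where "B2 = B1 \<union> w2 ` {..<m}"
  define B3 where "B3 = B2 \<union> w3 ` {..<m}"
  define B4 where "B4 = B3 \<union> w4 ` {..<m}"
  have B: "(i, a) \<in> B \<longleftrightarrow> i < t \<and> a < n \<and> a \<noteq> 0 \<and> a \<noteq> p i" for i a
    by (auto simp: B_def V_def)
  have B1: "(i, a) \<in> B1 \<longleftrightarrow> i < t \<and> a < n \<and> (a = 0 \<longrightarrow> odd i) \<and> a \<noteq> p i" for i a
    unfolding B1_def Un_iff B w1_def up using n by (auto simp: tm p_def)
  have B2: "(i, a) \<in> B2 \<longleftrightarrow> i < t \<and> a < n \<and> a \<noteq> p i" for i a
    unfolding B2_def Un_iff B1 w2_def down[OF order_refl] using n by (auto simp: tm p_def)
  have B3: "(i, a) \<in> B3 \<longleftrightarrow> i < t \<and> a < n \<and> (a = 1 \<longrightarrow> odd i)" for i a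
    unfolding B3_def Un_iff B2 w3_def up using n by (auto simp: tm p_def)
  have B4: "(i, a) \<in> B4 \<longleftrightarrow> i < t \<and> a < n" for i a
    unfolding B4_def Un_iff B3 w4_def down[OF order_refl] using n by (auto simp: tm)
  \<comment> \<open>Odd layers are white in columns 0 and 2 only. \<open>(2 * k, 2)\<close> is not
    adjacent to column 2, and column 0 of layer \<open>2 * k - 1\<close>, if there is one, was
    forced just before.\<close>
  have "(force_step ?G)\<^sup>*\<^sup>* B B1"
    unfolding B1_def
  proof (rule force_steps_chain[where u = "\<lambda>k. (2 * k, 2)"])
    fix k assume k: "k < m"
    then show "(2 * k, 2) \<in> B" using n by (simp add: B tm p_def)
    show "{v. ((2 * k, 2), v) \<in> parcs ?G \<and> v \<notin> B \<union> w1 ` {..<k}} = {w1 k}"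
      using k n unfolding w1_def
      by (simp only: set_eq_iff split_paired_All mem_Collect_eq Un_iff singleton_iff prod.inject
          up B parcs_path_times_complete)
        (auto simp: tm p_def; presburger)
  qed
  \<comment> \<open>The mirror image from the top: \<open>t - 1 - 2 * k\<close> is odd because
    \<open>t\<close> is even, and column 1 hides the second white column of the even layers.\<close>
  also have "(force_step ?G)\<^sup>*\<^sup>* B1 B2"
    unfolding B2_def
  proof (rule force_steps_chain[where u = "\<lambda>k. (t - 1 - 2 * k, 1)"])
    fix k assume k: "k < m"
    then show "(t - 1 - 2 * k, 1) \<in> B1" using n by (simp add: B1 tm p_def)
    show "{v. ((t - 1 - 2 * k, 1), v) \<in> parcs ?G \<and> v \<notin> B1 \<union> w2 ` {..<k}} = {w2 k}"
      using k n unfolding w2_def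
      by (simp only: set_eq_iff split_paired_All mem_Collect_eq Un_iff singleton_iff prod.inject
          down[OF less_imp_le[OF k]] B1 parcs_path_times_complete)
        (auto simp: tm p_def; presburger)
  qed
  \<comment> \<open>Column 0 is now blue everywhere and can force: one white vertex, in column
    \<open>p i\<close>, is left in each layer.\<close>
  also have "(force_step ?G)\<^sup>*\<^sup>* B2 B3"
    unfolding B3_def
  proof (rule force_steps_chain[where u = "\<lambda>k. (2 * k, 0)"])
    fix k assume k: "k < m"
    then show "(2 * k, 0) \<in> B2" using n by (simp add: B2 tm p_def)
    show "{v. ((2 * k, 0), v) \<in> parcs ?G \<and> v \<notin> B2 \<union> w3 ` {..<k}} = {w3 k}"
      using k n unfolding w3_def
      by (simp only: set_eq_iff split_paired_All mem_Collect_eq Un_iff singleton_iff prod.inject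
          up B2 parcs_path_times_complete)
        (auto simp: tm p_def; presburger)
  qed
  also have "(force_step ?G)\<^sup>*\<^sup>* B3 B4"
    unfolding B4_def
  proof (rule force_steps_chain[where u = "\<lambda>k. (t - 1 - 2 * k, 0)"])
    fix k assume k: "k < m"
    then show "(t - 1 - 2 * k, 0) \<in> B3" using n by (simp add: B3 tm p_def)
    show "{v. ((t - 1 - 2 * k, 0), v) \<in> parcs ?G \<and> v \<notin> B3 \<union> w4 ` {..<k}} = {w4 k}"
      using k n unfolding w4_def
      by (simp only: set_eq_iff split_paired_All mem_Collect_eq Un_iff singleton_iff prod.inject
          down[OF less_imp_le[OF k]] B3 parcs_path_times_complete)
        (auto simp: tm p_def; presburger)
  qed
  also have "B4 = pverts ?G" using B4 by auto
  finally have "zero_forcing_set ?G B"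
    by (auto simp: zero_forcing_set_def B)
  moreover have "card B = (n - 2) * t"
  proof -
    have "B = (SIGMA i:{0..<t}. {0..<n} - {0, p i})" by (auto simp: B)
    moreover have "card ({0..<n} - {0, p i}) = n - 2" for i
      using n by (subst card_Diff_subset) (auto simp: p_def)
    ultimately show ?thesis by (simp add: mult.commute)
  qed
  ultimately show ?thesis
    unfolding zero_forcing_number_def
    using finite_zero_forcing_sets[OF pair_graph_path_times_complete, of t n]
    by (metis (mono_tags, lifting) Min_le finite_imageI image_eqI mem_Collect_eq)
qed

text \<open>The bounds close the chain \<open>(n - 2) * t\<close> \<le> M \<le> Z \<le>
  \<open>(n - 2) * t\<close>.\<close>

theorem theorem2p4:
  fixes t n :: nat
  assumes "t \<ge> 2" and "even t" and "n \<ge> 3"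
  shows "max_nullity (tensor_product (path_graph t) (complete_graph n)) =
           zero_forcing_number (tensor_product (path_graph t) (complete_graph n)) \<and>
         zero_forcing_number (tensor_product (path_graph t) (complete_graph n)) = (n - 2) * t"
  using max_nullity_path_times_complete_ge[of n t] zero_forcing_number_path_times_complete_le[of t n]
    max_nullity_le_zero_forcing_number[OF pair_graph_path_times_complete, of t n] assms
  by linarith

end
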